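(* Let $k\ge2$ and $1\le t\le k$. For every $\epsilon>0$ there exist a piecewise linear function $\gamma:[-1,1]\to[0,1]$ and a constant $\epsilon'>0$ such that for every instance $\Psi$ of $\mathrm{Max}\text{-}\mathrm{B}\text{-}\mathrm{CSP}(\mathrm{Th}^t_k)$ and every real $\hat b$ with $(1-\epsilon')\mathrm{bias}_\Psi\le\hat b\le(1+\epsilon')\mathrm{bias}_\Psi$, we have $(\alpha(\mathrm{Th}^t_k)-\epsilon)\,\mathrm{val}_\Psi\le\gamma(\hat b)\le\mathrm{val}_\Psi$. Consequently, the algorithm which computes such an estimate $\hat b$ of $\mathrm{bias}_\Psi$ with a small-space sketch (with probability at least $2/3$) and outputs $\gamma(\hat b)$ is a sketching $(\alpha(\mathrm{Th}^t_k)-\epsilon)$-approximation algorithm for $\mathrm{Max}\text{-}\mathrm{B}\text{-}\mathrm{CSP}(\mathrm{Th}^t_k)$.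
   Context: $\mathrm{Th}^t_k:\mathbb Z_2^k\to\{0,1\}$, $\mathrm{Th}^t_k(\mathbf a)=1$ iff the Hamming weight $\|\mathbf a\|_0\ge t$. An instance $\Psi$ of $\mathrm{Max}\text{-}\mathrm{B}\text{-}\mathrm{CSP}(f)$ on $n$ variables is a list of constraints $(\mathbf b(\ell),\mathbf j(\ell),w(\ell))_{\ell\in[m]}$ with $\mathbf b(\ell)\in\mathbb Z_2^k$, $\mathbf j(\ell)\in[n]^k$ having distinct entries, and weights $w(\ell)\ge0$ with total $W_\Psi=\sum_\ell w(\ell)>0$. For $\mathbf x\in\mathbb Z_2^n$, $\mathrm{val}_\Psi(\mathbf x)=\frac1{W_\Psi}\sum_\ell w(\ell)f(\mathbf b(\ell)+\mathbf x|_{\mathbf j(\ell)})$ where $\mathbf x|_{\mathbf j}=(x_{j_1},\dots,x_{j_k})$ and addition is mod 2; $\mathrm{val}_\Psi=\max_{\mathbf x}\mathrm{val}_\Psi(\mathbf x)$. For $i\in[n]$, $\mathrm{bias}_\Psi(i)=\sum_{\ell\in[m],\,s\in[k]:\,j(\ell)_s=i}(-1)^{b(\ell)_s}w(\ell)$, and $\mathrm{bias}_\Psi=\frac1{kW_\Psi}\sum_{i=1}^n|\mathrm{bias}_\Psi(i)|$. $\mathcal B_p$ is the distribution on $\{0,1\}$ giving $0$ probability $p$ and $1$ probability $1-p$. For $f:\mathbb Z_2^k\to\{0,1\}$ and a distribution $\mathcal D$ on $\mathbb Z_2^k$: $\lambda_f(\mathcal D,p)=\mathbb E_{\mathbf b\sim\mathcal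 D,\mathbf a\sim\mathcal B_p^k}[f(\mathbf a+\mathbf b)]$, $\gamma_f(\mathcal D)=\lambda_f(\mathcal D,1)$, $\beta_f(\mathcal D)=\sup_{p}\lambda_f(\mathcal D,p)$, $\boldsymbol\mu(\mathcal D)_i=-\mathbb E_{\mathbf a\sim\mathcal D}[(-1)^{a_i}]$, and $\alpha(f)=\inf\{\beta_f(\mathcal D_N)/\gamma_f(\mathcal D_Y):\boldsymbol\mu(\mathcal D_N)=\boldsymbol\mu(\mathcal D_Y)\}$ (zero denominators read as $+\infty$). A sketching algorithm is a streaming algorithm (single pass over the constraints, small memory state) whose state on a concatenation of two streams can be computed from the states on the two parts. *)

theory Defs
  imports "HOL-Probability.Probability" "HOL-Library.Z2"
begin

text \<open>
  Vectors in \<open>\<int>\<^sub>2\<^sup>k\<close> are elements of \<open>bit ^ 'k\<close> with \<open>k = CARD('k)\<close>;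
  addition in \<open>bit\<close> is addition modulo 2. Predicates \<open>\<int>\<^sub>2\<^sup>k \<rightarrow> {0,1}\<close> are Boolean valued
  and turned into numbers by \<open>of_bool\<close>.
\<close>

instance bit :: finite
proof
  have "(UNIV :: bit set) = {0, 1}"
    by auto
  then show "finite (UNIV :: bit set)"
    by (metis finite.emptyI finite.insertI)
qed

definition hamming_weight :: "bit ^ 'k::finite \<Rightarrow> nat" where
  "hamming_weight a = card {i. a $ i \<noteq> 0}"

definition Th :: "nat \<Rightarrow> bit ^ 'k::finite \<Rightarrow> bool" where
  "Th t a \<longleftrightarrow> t \<le> hamming_weight a"

definition bit_sign :: "bit \<Rightarrow> real" where  \<comment> \<open>\<open>(-1)\<^sup>b\<close>\<close>
  "bit_sign b = (if b = 0 then 1 else - 1)"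


section \<open>Instances of Max-B-CSP(f)\<close>

datatype 'k constr = Constr (lits: "bit ^ 'k::finite") (vars: "nat ^ 'k") (weight: real)

definition valid_constr :: "nat \<Rightarrow> 'k::finite constr \<Rightarrow> bool" where
  "valid_constr n C \<longleftrightarrow>
     (\<forall>s. vars C $ s \<in> {1..n}) \<and> inj (\<lambda>s. vars C $ s) \<and> weight C \<ge> 0"

definition total_weight :: "'k::finite constr list \<Rightarrow> real" where
  "total_weight \<Psi> = (\<Sum>l<length \<Psi>. weight (\<Psi> ! l))"

definition csp_instance :: "nat \<Rightarrow> 'k::finite constr list \<Rightarrow> bool" where
  "csp_instance n \<Psi> \<longleftrightarrow> (\<forall>C\<in>set \<Psi>. valid_constr n C) \<and> total_weight \<Psi> > 0"

definition restrict_to :: "(nat \<Rightarrow> bit) \<Rightarrow> nat ^ 'k::finite \<Rightarrow> bit ^ 'k" where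
  "restrict_to x j = (\<chi> s. x (j $ s))"

definition val_at :: "(bit ^ 'k::finite \<Rightarrow> bool) \<Rightarrow> 'k constr list \<Rightarrow> (nat \<Rightarrow> bit) \<Rightarrow> real" where
  "val_at f \<Psi> x = 1 / total_weight \<Psi> *
     (\<Sum>l<length \<Psi>. weight (\<Psi> ! l) * of_bool (f (lits (\<Psi> ! l) + restrict_to x (vars (\<Psi> ! l)))))"

definition val :: "(bit ^ 'k::finite \<Rightarrow> bool) \<Rightarrow> nat \<Rightarrow> 'k constr list \<Rightarrow> real" where
  "val f n \<Psi> = Max (val_at f \<Psi> ` ({1..n} \<rightarrow>\<^sub>E UNIV))"

definition bias_at :: "'k::finite constr list \<Rightarrow> nat \<Rightarrow> real" where
  "bias_at \<Psi> i =
     (\<Sum>(l, s) \<in> {(l, s). l < length \<Psi> \<and> vars (\<Psi> ! l) $ s = i}.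
        bit_sign (lits (\<Psi> ! l) $ s) * weight (\<Psi> ! l))"

definition bias :: "nat \<Rightarrow> 'k::finite constr list \<Rightarrow> real" where
  "bias n \<Psi> = 1 / (real CARD('k) * total_weight \<Psi>) * (\<Sum>i=1..n. \<bar>bias_at \<Psi> i\<bar>)"


section \<open>The approximation ratio\<close>

definition B_pmf :: "real \<Rightarrow> bit pmf" where  \<comment> \<open>\<open>0\<close> has probability \<open>p\<close>\<close>
  "B_pmf p = map_pmf (\<lambda>z. if z then 0 else 1) (bernoulli_pmf p)"

definition B_vec_pmf :: "real \<Rightarrow> (bit ^ 'k::finite) pmf" where
  "B_vec_pmf p = map_pmf vec_lambda (Pi_pmf UNIV 0 (\<lambda>_. B_pmf p))"

definition csp_lambda :: "(bit ^ 'k::finite \<Rightarrow> bool) \<Rightarrow> (bit ^ 'k) pmf \<Rightarrow> real \<Rightarrow> real" where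
  "csp_lambda f D p =
     measure_pmf.expectation (pair_pmf D (B_vec_pmf p)) (\<lambda>(b, a). of_bool (f (a + b)))"

definition csp_gamma :: "(bit ^ 'k::finite \<Rightarrow> bool) \<Rightarrow> (bit ^ 'k) pmf \<Rightarrow> real" where
  "csp_gamma f D = csp_lambda f D 1"

definition csp_beta :: "(bit ^ 'k::finite \<Rightarrow> bool) \<Rightarrow> (bit ^ 'k) pmf \<Rightarrow> real" where
  "csp_beta f D = (SUP p\<in>{0..1}. csp_lambda f D p)"

definition csp_mu :: "(bit ^ 'k::finite) pmf \<Rightarrow> real ^ 'k" where
  "csp_mu D = (\<chi> i. - measure_pmf.expectation D (\<lambda>a. bit_sign (a $ i)))"

text \<open>
  Omitting the pairs with \<open>csp_gamma f D\<^sub>Y = 0\<close> amounts to giving the ratio the value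
  \<open>\<infinity>\<close> there. The set is nonempty as soon as \<open>f\<close> is satisfiable.
\<close>

definition csp_alpha :: "(bit ^ 'k::finite \<Rightarrow> bool) \<Rightarrow> real" where
  "csp_alpha f =
     Inf {csp_beta f D\<^sub>N / csp_gamma f D\<^sub>Y | D\<^sub>N D\<^sub>Y. csp_mu D\<^sub>N = csp_mu D\<^sub>Y \<and> csp_gamma f D\<^sub>Y \<noteq> 0}"


section \<open>Piecewise linear functions\<close>

text \<open>
  The affine pieces are required on closed intervals, so such functions are continuous.
\<close>

definition piecewise_linear_on :: "real \<Rightarrow> real \<Rightarrow> (real \<Rightarrow> real) \<Rightarrow> bool" where
  "piecewise_linear_on a b g \<longleftrightarrow>
     (\<exists>(N::nat) x. x 0 = a \<and> x N = b \<and>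
        (\<forall>i<N. x i < x (Suc i) \<and> (\<exists>m c. \<forall>y\<in>{x i..x (Suc i)}. g y = m * y + c)))"


section \<open>Sketching algorithms\<close>

text \<open>
  A deterministic streaming algorithm reads the constraints one by one and keeps a bit string
  as memory state.
\<close>

datatype 'k streaming_alg =
  Streaming_Alg (init: "bool list")
    (step: "bool list \<Rightarrow> 'k::finite constr \<Rightarrow> bool list")
    (out: "bool list \<Rightarrow> real")

definition state :: "'k::finite streaming_alg \<Rightarrow> 'k constr list \<Rightarrow> bool list" where
  "state A \<sigma> = foldl (step A) (init A) \<sigma>"

definition alg_output :: "'k::finite streaming_alg \<Rightarrow> 'k constr list \<Rightarrow> real" where
  "alg_output A \<sigma> = out A (state A \<sigma>)"

definition streams :: "nat \<Rightarrow> 'k::finite constr list set" where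
  "streams n = {\<sigma>. \<forall>C\<in>set \<sigma>. valid_constr n C}"

definition det_sketching :: "nat \<Rightarrow> nat \<Rightarrow> 'k::finite streaming_alg \<Rightarrow> bool" where
  "det_sketching n s A \<longleftrightarrow>
     (\<forall>\<sigma>\<in>streams n. length (state A \<sigma>) \<le> s) \<and>
     (\<exists>comb. \<forall>\<sigma>\<in>streams n. \<forall>\<tau>\<in>streams n. state A (\<sigma> @ \<tau>) = comb (state A \<sigma>) (state A \<tau>))"

text \<open>
  A randomized algorithm on \<open>n\<close> variables is a deterministic one chosen by a random seed. Seeds are
  infinite bit strings with an arbitrary distribution, and the full algorithm is a family
  indexed by \<open>n\<close>. The space bound \<open>s\<close> counts the bits of memory as a function of \<open>n\<close>.
\<close>

datatype 'k rand_alg =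
  Rand_Alg (seed: "(nat \<Rightarrow> bool) measure") (run: "(nat \<Rightarrow> bool) \<Rightarrow> 'k::finite streaming_alg")

definition sketching_algorithm :: "(nat \<Rightarrow> nat) \<Rightarrow> (nat \<Rightarrow> 'k::finite rand_alg) \<Rightarrow> bool" where
  "sketching_algorithm s R \<longleftrightarrow>
     (\<forall>n. prob_space (seed (R n)) \<and>
          (\<forall>\<omega>\<in>space (seed (R n)). det_sketching n (s n) (run (R n) \<omega>)) \<and>
          (\<forall>\<sigma>\<in>streams n. (\<lambda>\<omega>. alg_output (run (R n) \<omega>) \<sigma>) \<in> borel_measurable (seed (R n))))"

definition outputs_in :: "'k::finite rand_alg \<Rightarrow> 'k constr list \<Rightarrow> real set \<Rightarrow> bool" where
  "outputs_in R \<Psi> V \<longleftrightarrow>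
     measure (seed R) {\<omega> \<in> space (seed R). alg_output (run R \<omega>) \<Psi> \<in> V} \<ge> 2/3"

text \<open>
  \<open>I n\<close> is the class of admissible inputs on \<open>n\<close> variables, for example all instances, or those with
  polynomially bounded integer weights. Such a parameter is needed because no algorithm whose
  memory is bounded in terms of \<open>n\<close> alone estimates the bias of all real-weighted instances.
\<close>

definition sketching_bias_estimator ::
    "(nat \<Rightarrow> 'k::finite constr list set) \<Rightarrow> real \<Rightarrow> (nat \<Rightarrow> nat) \<Rightarrow> (nat \<Rightarrow> 'k rand_alg) \<Rightarrow> bool" where
  "sketching_bias_estimator I \<delta> s R \<longleftrightarrow>
     sketching_algorithm s R \<and>
     (\<forall>n. \<forall>\<Psi>\<in>I n. csp_instance n \<Psi> \<longrightarrow>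
        outputs_in (R n) \<Psi> {(1 - \<delta>) * bias n \<Psi>..(1 + \<delta>) * bias n \<Psi>})"

definition sketching_approximation ::
    "(bit ^ 'k::finite \<Rightarrow> bool) \<Rightarrow> real \<Rightarrow> (nat \<Rightarrow> 'k constr list set) \<Rightarrow> (nat \<Rightarrow> nat) \<Rightarrow>
     (nat \<Rightarrow> 'k rand_alg) \<Rightarrow> bool" where
  "sketching_approximation f \<rho> I s R \<longleftrightarrow>
     sketching_algorithm s R \<and>
     (\<forall>n. \<forall>\<Psi>\<in>I n. csp_instance n \<Psi> \<longrightarrow>
        outputs_in (R n) \<Psi> {\<rho> * val f n \<Psi>..val f n \<Psi>})"

definition apply_to_output :: "(real \<Rightarrow> real) \<Rightarrow> 'k::finite rand_alg \<Rightarrow> 'k rand_alg" where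
  "apply_to_output g R =
     Rand_Alg (seed R)
       (\<lambda>\<omega>. Streaming_Alg (init (run R \<omega>)) (step (run R \<omega>)) (g \<circ> out (run R \<omega>)))"

end

theory Submission
  imports Defs "HOL-Combinatorics.Permutations"
begin

text \<open>
  Let \<open>G b = min 1 (k(1 + b) / 2t)\<close>. By Markov's inequality, an assignment whose literals have mean
  weight \<open>h\<close> satisfies at most a fraction \<open>h / t\<close> of the constraints, and the bias bounds \<open>h\<close> by
  \<open>k(1 + b) / 2\<close>; so the value is at most \<open>G b\<close>. Conversely, the majority assignment attains this mean
  weight. Flipping it at random shows that the value is at least \<open>\<beta>(D)\<close> for the induced distribution
  \<open>D\<close>. After a random permutation of the coordinates, \<open>D\<close> has the same \<open>\<mu>\<close> as an extremal
  distribution for Markov's inequality, whose \<open>\<gamma>\<close> is \<open>G b\<close>; so \<open>\<beta>(D) \<ge> \<alpha> G b\<close>. Hence the value lies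
  between \<open>\<alpha> G b\<close> and \<open>G b\<close>. As \<open>G\<close> is Lipschitz and at least \<open>1/2\<close> on \<open>[0, 1]\<close>, the function
  \<open>max 0 (\<alpha> - \<epsilon>/2) * G\<close> tolerates a small relative error in \<open>b\<close>.
\<close>

lemma integrable_finite_type [simp]:
  fixes D :: "'a::finite pmf" and h :: "'a \<Rightarrow> real"
  shows "integrable (measure_pmf D) h"
  by (rule integrable_measure_pmf_finite) simp

section \<open>Symmetrization\<close>

definition permute_coords :: "('k \<Rightarrow> 'k) \<Rightarrow> 'a ^ 'k \<Rightarrow> 'a ^ 'k::finite" where
  "permute_coords \<pi> a = (\<chi> i. a $ \<pi> i)"

text \<open>A random permutation of the coordinates makes \<open>csp_mu\<close> a constant vector
  determined by the mean Hamming weight. Two distributions that share only this mean thus become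
  comparable in the infimum \<open>csp_alpha\<close>.\<close>

definition symmetrize :: "('a ^ 'k::finite) pmf \<Rightarrow> ('a ^ 'k) pmf" where
  "symmetrize D = pmf_of_set {\<pi>. \<pi> permutes UNIV} \<bind> (\<lambda>\<pi>. map_pmf (permute_coords \<pi>) D)"

lemma expectation_symmetrize:
  fixes D :: "('a::finite ^ 'k::finite) pmf" and h :: "'a ^ 'k \<Rightarrow> real"
  shows "measure_pmf.expectation (symmetrize D) h =
    measure_pmf.expectation D (\<lambda>a. (\<Sum>\<pi> | \<pi> permutes UNIV. h (permute_coords \<pi> a)) / fact CARD('k))"
proof -
  have ne: "{\<pi>::'k \<Rightarrow> 'k. \<pi> permutes UNIV} \<noteq> {}"
    using permutes_id by blast
  have fin: "finite {\<pi>::'k \<Rightarrow> 'k. \<pi> permutes UNIV}"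
    by (simp add: finite_permutations)
  have card: "card {\<pi>::'k \<Rightarrow> 'k. \<pi> permutes UNIV} = fact CARD('k)"
    by (rule card_permutations) auto
  show ?thesis
    unfolding symmetrize_def
    by (subst pmf_expectation_bind_pmf_of_set[OF ne fin])
      (simp_all add: card sum_distrib_left divide_inverse_commute)
qed

lemma expectation_symmetrize_invariant:
  fixes D :: "('a::finite ^ 'k::finite) pmf" and h :: "'a ^ 'k \<Rightarrow> real"
  assumes "\<And>\<pi> a. \<pi> permutes UNIV \<Longrightarrow> h (permute_coords \<pi> a) = h a"
  shows "measure_pmf.expectation (symmetrize D) h = measure_pmf.expectation D h"
proof -
  have card: "card {\<pi>::'k \<Rightarrow> 'k. \<pi> permutes UNIV} = fact CARD('k)"
    by (rule card_permutations) auto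
  show ?thesis
    by (simp add: expectation_symmetrize assms card)
qed

text \<open>A uniformly random permutation sends \<open>i\<close> to a uniformly random
  coordinate.\<close>

lemma sum_permutes_nth:
  fixes a :: "'a ^ 'k::finite" and g :: "'a \<Rightarrow> real"
  shows "(\<Sum>\<pi> | \<pi> permutes UNIV. g (a $ \<pi> i)) / fact CARD('k) = (\<Sum>j\<in>UNIV. g (a $ j)) / CARD('k)"
proof -
  let ?P = "{\<pi>::'k \<Rightarrow> 'k. \<pi> permutes UNIV}"
  have card: "card ?P = fact CARD('k)"
    by (rule card_permutations) auto
  \<comment> \<open>Composition on the right with the transposition of \<open>i\<close> and
    \<open>j\<close> is an involution on the permutations and swaps the values at \<open>i\<close>
    and \<open>j\<close>.\<close>
  have indep: "(\<Sum>\<pi>\<in>?P. g (a $ \<pi> j)) = (\<Sum>\<pi>\<in>?P. g (a $ \<pi> i))" for j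
    by (rule sum.reindex_bij_witness[of _ "\<lambda>\<pi>. \<pi> \<circ> Transposition.transpose i j"
          "\<lambda>\<pi>. \<pi> \<circ> Transposition.transpose i j"])
      (auto simp: o_assoc[symmetric] intro!: permutes_compose permutes_swap_id)
  have "CARD('k) * (\<Sum>\<pi>\<in>?P. g (a $ \<pi> i)) = (\<Sum>j\<in>(UNIV :: 'k set). \<Sum>\<pi>\<in>?P. g (a $ \<pi> i))"
    by simp
  also have "\<dots> = (\<Sum>j\<in>UNIV. \<Sum>\<pi>\<in>?P. g (a $ \<pi> j))"
    by (rule sum.cong[OF refl indep[symmetric]])
  also have "\<dots> = (\<Sum>\<pi>\<in>?P. \<Sum>j\<in>UNIV. g (a $ \<pi> j))"
    by (rule sum.swap)
  also have "\<dots> = (\<Sum>\<pi>\<in>?P. \<Sum>j\<in>UNIV. g (a $ j))"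
    by (intro sum.cong refl sum.permute[unfolded o_def, symmetric]) auto
  also have "\<dots> = fact CARD('k) * (\<Sum>j\<in>UNIV. g (a $ j))"
    by (simp add: card)
  finally show ?thesis
    by (simp add: field_simps)
qed

section \<open>Threshold predicates\<close>

lemma hamming_weight_permute_coords:
  assumes "\<pi> permutes UNIV"
  shows "hamming_weight (permute_coords \<pi> a) = hamming_weight a"
proof -
  have "bij \<pi>"
    using assms by (rule permutes_bij)
  then have "{i. a $ i \<noteq> 0} = \<pi> ` {i. a $ \<pi> i \<noteq> 0}"
    by (auto simp: image_iff) (metis bij_pointE)
  moreover have "card (\<pi> ` {i. a $ \<pi> i \<noteq> 0}) = card {i. a $ \<pi> i \<noteq> 0}"
    using \<open>bij \<pi>\<close> by (intro card_image) (auto simp: bij_def inj_on_def)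
  ultimately show ?thesis
    by (simp add: hamming_weight_def permute_coords_def)
qed

lemma sum_bit_sign:
  fixes a :: "bit ^ 'k::finite"
  shows "(\<Sum>i\<in>UNIV. bit_sign (a $ i)) = CARD('k) - 2 * real (hamming_weight a)"
proof -
  have "bit_sign b = 1 - 2 * of_bool (b \<noteq> 0)" for b
    by (simp add: bit_sign_def)
  then show ?thesis
    by (simp add: sum_subtractf sum_distrib_left[symmetric] hamming_weight_def)
qed

lemma hamming_weight_le: "hamming_weight (a :: bit ^ 'k::finite) \<le> CARD('k)"
  unfolding hamming_weight_def by (rule card_mono) auto

lemma exists_hamming_weight:
  assumes "n \<le> CARD('k::finite)"
  obtains a :: "bit ^ 'k" where "hamming_weight a = n"
proof -
  obtain S :: "'k set" where "card S = n"
    using obtain_subset_with_card_n[OF assms] by auto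
  then have "hamming_weight (\<chi> i. if i \<in> S then 1 else 0) = n"
    by (simp add: hamming_weight_def)
  then show thesis
    by (rule that)
qed

section \<open>Mean vector and noisy expectation of a symmetrized distribution\<close>

lemma csp_mu_symmetrize:
  fixes D :: "(bit ^ 'k::finite) pmf"
  shows "csp_mu (symmetrize D) =
    (\<chi> i. 2 * measure_pmf.expectation D (\<lambda>a. real (hamming_weight a)) / CARD('k) - 1)"
proof -
  \<comment> \<open>After averaging, the sign at \<open>i\<close> becomes the mean of all signs,
    which \<open>sum_bit_sign\<close> expresses through the weight.\<close>
  have "measure_pmf.expectation (symmetrize D) (\<lambda>a. bit_sign (a $ i)) =
      measure_pmf.expectation D (\<lambda>a. 1 - 2 / CARD('k) * real (hamming_weight a))" for i
    by (simp add: expectation_symmetrize permute_coords_def sum_permutes_nth sum_bit_sign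
        diff_divide_distrib)
  then show ?thesis
    by (simp add: csp_mu_def)
qed

lemma csp_lambda_eq:
  "csp_lambda f D p = measure_pmf.expectation D
     (\<lambda>b. measure_pmf.expectation (B_vec_pmf p) (\<lambda>a. of_bool (f (a + b))))"
  unfolding csp_lambda_def pair_pmf_def
  by (subst pmf_expectation_bind[of UNIV])
    (simp_all add: map_pmf_def[symmetric] integral_measure_pmf[of UNIV D])

lemma B_vec_pmf_permute_coords:
  assumes "\<pi> permutes (UNIV :: 'k::finite set)"
  shows "map_pmf (permute_coords \<pi>) (B_vec_pmf p) = (B_vec_pmf p :: (bit ^ 'k) pmf)"
proof -
  have "Pi_pmf UNIV 0 (\<lambda>_. B_pmf p) = map_pmf (\<lambda>g. g \<circ> \<pi>) (Pi_pmf UNIV 0 (\<lambda>_. B_pmf p))"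
    using assms by (intro Pi_pmf_bij_betw) (auto simp: permutes_bij)
  then have "B_vec_pmf p =
      map_pmf vec_lambda (map_pmf (\<lambda>g. g \<circ> \<pi>) (Pi_pmf UNIV 0 (\<lambda>_. B_pmf p)))"
    by (simp only: B_vec_pmf_def)
  also have "\<dots> = map_pmf (permute_coords \<pi>) (B_vec_pmf p)"
    by (simp add: B_vec_pmf_def map_pmf_comp permute_coords_def o_def)
  finally show ?thesis ..
qed

text \<open>The noise has i.i.d. coordinates, so it can be permuted together with \<open>b\<close>;
  the invariance of \<open>f\<close> then removes the permutation.\<close>

lemma csp_lambda_symmetrize:
  fixes D :: "(bit ^ 'k::finite) pmf"
  assumes "\<And>\<pi> a. \<pi> permutes UNIV \<Longrightarrow> f (permute_coords \<pi> a) = f a"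
  shows "csp_lambda f (symmetrize D) p = csp_lambda f D p"
  unfolding csp_lambda_eq
proof (rule expectation_symmetrize_invariant)
  fix \<pi> :: "'k \<Rightarrow> 'k" and b :: "bit ^ 'k"
  assume \<pi>: "\<pi> permutes UNIV"
  have "measure_pmf.expectation (B_vec_pmf p) (\<lambda>a. of_bool (f (a + permute_coords \<pi> b))) =
      measure_pmf.expectation (B_vec_pmf p)
        (\<lambda>a. of_bool (f (permute_coords \<pi> a + permute_coords \<pi> b)) :: real)"
    by (subst B_vec_pmf_permute_coords[OF \<pi>, symmetric]) simp
  also have "\<dots> = measure_pmf.expectation (B_vec_pmf p) (\<lambda>a. of_bool (f (permute_coords \<pi> (a + b))))"
    by (intro arg_cong[of _ _ "measure_pmf.expectation _"] ext arg_cong[of _ _ "\<lambda>x. of_bool (f x)"])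
      (simp add: permute_coords_def vec_eq_iff)
  also have "\<dots> = measure_pmf.expectation (B_vec_pmf p) (\<lambda>a. of_bool (f (a + b)))"
    by (simp add: assms[OF \<pi>])
  finally show "measure_pmf.expectation (B_vec_pmf p) (\<lambda>a. of_bool (f (a + permute_coords \<pi> b))) =
      (measure_pmf.expectation (B_vec_pmf p) (\<lambda>a. of_bool (f (a + b))) :: real)" .
qed

lemma csp_gamma_eq:
  fixes f :: "bit ^ 'k::finite \<Rightarrow> bool"
  shows "csp_gamma f D = measure_pmf.expectation D (\<lambda>b. of_bool (f b))"
proof -
  have "bernoulli_pmf 1 = return_pmf True"
    by (rule pmf_eqI) (auto simp: indicator_def split: bool.splits)
  then have "B_vec_pmf 1 = (return_pmf 0 :: (bit ^ 'k) pmf)"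
    by (simp add: B_vec_pmf_def B_pmf_def zero_vec_def)
  then show ?thesis
    by (simp add: csp_gamma_def csp_lambda_eq)
qed

section \<open>Bounds on the quantities in the approximation ratio\<close>

lemma csp_lambda_bounds: "0 \<le> csp_lambda f D p" "csp_lambda f D p \<le> 1"
  unfolding csp_lambda_def
  by (auto intro!: integral_nonneg measure_pmf.integral_le_const simp: case_prod_unfold)

lemma csp_lambda_le_beta:
  assumes "p \<in> {0..1}"
  shows "csp_lambda f D p \<le> csp_beta f D"
  unfolding csp_beta_def using assms csp_lambda_bounds(2)
  by (intro cSUP_upper bdd_aboveI2[where M = 1]) auto

lemma csp_beta_nonneg: "0 \<le> csp_beta f D"
  using csp_lambda_bounds(1)[of f D 0] csp_lambda_le_beta[of 0 f D] by simp

lemma csp_gamma_nonneg: "0 \<le> csp_gamma f D"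
  by (simp add: csp_gamma_def csp_lambda_bounds)

lemma csp_beta_le:
  assumes "\<And>p. csp_lambda f D p \<le> c"
  shows "csp_beta f D \<le> c"
  unfolding csp_beta_def using assms by (intro cSUP_least) auto

lemma csp_alpha_le:
  assumes "csp_mu D\<^sub>N = csp_mu D\<^sub>Y" and "csp_gamma f D\<^sub>Y \<noteq> 0"
  shows "csp_alpha f \<le> csp_beta f D\<^sub>N / csp_gamma f D\<^sub>Y"
  unfolding csp_alpha_def
proof (rule cInf_lower)
  \<comment> \<open>The real infimum is a lower bound only of sets bounded below; here all ratios
    are nonnegative.\<close>
  show "bdd_below {csp_beta f D\<^sub>N / csp_gamma f D\<^sub>Y |D\<^sub>N D\<^sub>Y.
      csp_mu D\<^sub>N = csp_mu D\<^sub>Y \<and> csp_gamma f D\<^sub>Y \<noteq> 0}"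
    by (rule bdd_belowI[of _ 0]) (auto simp: csp_beta_nonneg csp_gamma_nonneg)
qed (use assms in auto)

text \<open>The point mass at a satisfying vector, taken on both sides, gives a ratio of at most
  1.\<close>

lemma csp_alpha_le_1:
  assumes "f a"
  shows "csp_alpha f \<le> 1"
proof -
  have "csp_gamma f (return_pmf a) = 1"
    using assms by (simp add: csp_gamma_eq)
  moreover have "csp_beta f (return_pmf a) \<le> 1"
    by (intro csp_beta_le csp_lambda_bounds)
  ultimately show ?thesis
    using csp_alpha_le[of "return_pmf a" "return_pmf a" f] by simp
qed

text \<open>
  Equality in Markov's inequality: the largest probability of weight at least \<open>t\<close> compatible with a
  mean weight \<open>h\<close> is attained on the weights \<open>0, t\<close> if \<open>h \<le> t\<close>, and on \<open>t, k\<close> otherwise.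
\<close>

lemma Markov_extremal_pmf:
  fixes h :: real
  assumes "1 \<le> t" "t \<le> CARD('k::finite)" "0 \<le> h" "h \<le> CARD('k)"
  obtains D :: "(bit ^ 'k) pmf"
  where "measure_pmf.expectation D (\<lambda>a. real (hamming_weight a)) = h"
    and "csp_gamma (Th t) D = min 1 (h / t)"
proof -
  obtain u :: "bit ^ 'k" where u: "hamming_weight u = t"
    using assms(2) exists_hamming_weight by blast
  show thesis
  proof (cases "h \<le> t")
    case True
    define q where "q = h / t"
    have q: "0 \<le> q" "q \<le> 1" "q * t = h"
      using True assms by (auto simp: q_def)
    have 0: "hamming_weight (0 :: bit ^ 'k) = 0"
      by (simp add: hamming_weight_def)
    show thesis
      using q 0 u assms(1)
      by (intro that[of "map_pmf (\<lambda>z. if z then u else 0) (bernoulli_pmf q)"])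
        (auto simp: csp_gamma_eq Th_def q_def mult.commute)
  next
    case False
    obtain v :: "bit ^ 'k" where v: "hamming_weight v = CARD('k)"
      using exists_hamming_weight by blast
    \<comment> \<open>Solves \<open>CARD('k) * q + t * (1 - q) = h\<close>, so that the mixture of
      \<open>v\<close> and \<open>u\<close> has mean weight \<open>h\<close>.\<close>
    define q where "q = (h - t) / (CARD('k) - t)"
    have tk: "real t < CARD('k)"
      using False assms by linarith
    have "q * (CARD('k) - t) = h - t"
      using tk by (simp add: q_def)
    then have q: "0 \<le> q" "q \<le> 1" "CARD('k) * q + t * (1 - q) = h"
      using False assms tk by (simp_all add: q_def[symmetric] algebra_simps) (simp_all add: q_def)
    show thesis
      using q u v False assms
      by (intro that[of "map_pmf (\<lambda>z. if z then v else u) (bernoulli_pmf q)"])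
        (auto simp: csp_gamma_eq Th_def min_def divide_simps)
  qed
qed

lemma Th_permute_coords:
  "\<pi> permutes UNIV \<Longrightarrow> Th t (permute_coords \<pi> a) = Th t a"
  by (simp add: Th_def hamming_weight_permute_coords)

text \<open>Symmetrizing \<open>D\<close> and the extremal \<open>E\<close> makes their mean vectors
  agree and preserves \<beta> and \<gamma>. The pair is then admissible for
  \<open>csp_alpha\<close>, with ratio \<open>csp_beta (Th t) D / min 1 (h / t)\<close>.\<close>

lemma csp_alpha_Th_le_beta:
  fixes D :: "(bit ^ 'k::finite) pmf"
  assumes "1 \<le> t" "t \<le> CARD('k)"
  defines "h \<equiv> measure_pmf.expectation D (\<lambda>a. real (hamming_weight a))"
  assumes "h > 0"
  shows "csp_alpha (Th t :: bit ^ 'k \<Rightarrow> bool) * min 1 (h / t) \<le> csp_beta (Th t) D"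
proof -
  have "h \<le> CARD('k)"
    unfolding h_def by (rule measure_pmf.integral_le_const) (auto simp: hamming_weight_le)
  then obtain E :: "(bit ^ 'k) pmf"
    where E: "measure_pmf.expectation E (\<lambda>a. real (hamming_weight a)) = h"
      "csp_gamma (Th t) E = min 1 (h / t)"
    using Markov_extremal_pmf[OF assms(1,2), of h] \<open>h > 0\<close> by auto
  have sym: "csp_lambda (Th t) (symmetrize F) p = csp_lambda (Th t) F p" for F :: "(bit ^ 'k) pmf" and p
    by (rule csp_lambda_symmetrize) (rule Th_permute_coords)
  have "csp_mu (symmetrize D) = csp_mu (symmetrize E)"
    unfolding csp_mu_symmetrize E(1) h_def ..
  moreover have "csp_gamma (Th t) (symmetrize E) = min 1 (h / t)"
    using E(2) by (simp only: csp_gamma_def sym)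
  moreover have "csp_beta (Th t) (symmetrize D) = csp_beta (Th t) D"
    by (simp only: csp_beta_def sym)
  moreover have "min 1 (h / t) > 0"
    using assms by simp
  ultimately show ?thesis
    using csp_alpha_le[of "symmetrize D" "symmetrize E" "Th t"] by (simp add: pos_le_divide_eq)
qed

section \<open>The value and the bias of an instance\<close>

text \<open>A constraint is drawn by its position with probability proportional to its weight, and
  the vector it sees under \<open>x\<close> is returned. For a valid instance, \<gamma> of this law
  is the value at \<open>x\<close>, and \<lambda> is the expected value after random flips of
  \<open>x\<close>.\<close>

definition instance_pmf :: "'k::finite constr list \<Rightarrow> (nat \<Rightarrow> bit) \<Rightarrow> (bit ^ 'k) pmf" where
  "instance_pmf \<Psi> x = map_pmf (\<lambda>l. lits (\<Psi> ! l) + restrict_to x (vars (\<Psi> ! l)))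
     (embed_pmf (\<lambda>l. if l < length \<Psi> then weight (\<Psi> ! l) / total_weight \<Psi> else 0))"

lemma csp_instanceD:
  assumes "csp_instance n \<Psi>"
  shows "total_weight \<Psi> > 0"
    and "l < length \<Psi> \<Longrightarrow> weight (\<Psi> ! l) \<ge> 0"
    and "l < length \<Psi> \<Longrightarrow> vars (\<Psi> ! l) $ s \<in> {1..n}"
    and "l < length \<Psi> \<Longrightarrow> inj (($) (vars (\<Psi> ! l)))"
  using assms nth_mem[of l \<Psi>] by (auto simp: csp_instance_def valid_constr_def)

lemma expectation_instance_pmf:
  fixes h :: "bit ^ 'k::finite \<Rightarrow> real"
  assumes "csp_instance n \<Psi>"
  shows "measure_pmf.expectation (instance_pmf \<Psi> x) h =
    1 / total_weight \<Psi> *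
      (\<Sum>l<length \<Psi>. weight (\<Psi> ! l) * h (lits (\<Psi> ! l) + restrict_to x (vars (\<Psi> ! l))))"
proof -
  define w where "w = (\<lambda>l. if l < length \<Psi> then weight (\<Psi> ! l) / total_weight \<Psi> else 0)"
  note inst = csp_instanceD[OF assms]
  have nonneg: "0 \<le> w l" for l
    using inst(1,2) by (simp add: w_def)
  have "(\<integral>\<^sup>+l. ennreal (w l) \<partial>count_space UNIV) = (\<Sum>l<length \<Psi>. ennreal (w l))"
    by (rule nn_integral_count_space'[of "{..<length \<Psi>}"]) (auto simp: w_def)
  also have "\<dots> = ennreal (\<Sum>l<length \<Psi>. w l)"
    using nonneg by (rule sum_ennreal)
  also have "(\<Sum>l<length \<Psi>. w l) = 1"
    using inst(1) by (simp add: w_def sum_divide_distrib[symmetric] total_weight_def)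
  finally have pmf: "pmf (embed_pmf w) l = w l" for l
    using nonneg by (subst pmf_embed_pmf) simp_all
  have "l < length \<Psi>" if "w l \<noteq> 0" for l
    using that by (simp add: w_def split: if_splits)
  then have "measure_pmf.expectation (embed_pmf w) g = (\<Sum>l<length \<Psi>. w l * g l)" for g :: "nat \<Rightarrow> real"
    by (subst integral_measure_pmf[of "{..<length \<Psi>}"]) (auto simp: set_pmf_eq pmf)
  then show ?thesis
    unfolding instance_pmf_def integral_map_pmf w_def[symmetric]
    by (simp add: w_def sum_distrib_left)
qed

lemma val_at_eq_expectation:
  assumes "csp_instance n \<Psi>"
  shows "val_at f \<Psi> x = measure_pmf.expectation (instance_pmf \<Psi> x) (\<lambda>a. of_bool (f a))"
  by (simp add: val_at_def expectation_instance_pmf[OF assms])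

lemma finite_assignments: "finite ({1..n::nat} \<rightarrow>\<^sub>E (UNIV :: bit set))"
  by (intro finite_PiE) auto

text \<open>The maximum ranges over extensional functions on \<open>{1..n}\<close>, while
  \<open>x\<close> is arbitrary; values outside this range are never read.\<close>

lemma val_at_le_val:
  assumes "csp_instance n \<Psi>"
  shows "val_at f \<Psi> x \<le> val f n \<Psi>"
proof -
  have "restrict_to (restrict x {1..n}) (vars (\<Psi> ! l)) = restrict_to x (vars (\<Psi> ! l))"
    if "l < length \<Psi>" for l
    using csp_instanceD(3)[OF assms that] by (simp add: restrict_to_def vec_eq_iff)
  then have "val_at f \<Psi> x = val_at f \<Psi> (restrict x {1..n})"
    by (simp add: val_at_def)
  then show ?thesis
    unfolding val_def using finite_assignments by (intro Max_ge) auto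
qed

lemma val_attained:
  obtains x where "val f n \<Psi> = val_at f \<Psi> x"
proof -
  have "val f n \<Psi> \<in> val_at f \<Psi> ` ({1..n} \<rightarrow>\<^sub>E UNIV)"
    unfolding val_def using finite_assignments by (intro Max_in) (auto simp: PiE_eq_empty_iff)
  then show thesis
    using that by auto
qed

lemma val_nonneg:
  assumes "csp_instance n \<Psi>"
  shows "0 \<le> val f n \<Psi>"
proof -
  obtain x where "val f n \<Psi> = val_at f \<Psi> x"
    by (rule val_attained)
  then show ?thesis
    by (simp add: val_at_eq_expectation[OF assms])
qed

text \<open>Distinct variables receive independent flips, so each single constraint sees noise with
  the product law.\<close>

lemma B_vec_pmf_restrict:
  fixes j :: "nat ^ 'k::finite"
  assumes "\<And>s. j $ s \<in> {1..n}" and "inj (($) j)"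
  shows "map_pmf (\<lambda>y. restrict_to y j) (Pi_pmf {1..n} 0 (\<lambda>_. B_pmf p)) = B_vec_pmf p"
proof -
  have "Pi_pmf UNIV 0 (\<lambda>_::'k. B_pmf p) =
      map_pmf (\<lambda>g. g \<circ> ($) j) (Pi_pmf (range (($) j)) 0 (\<lambda>_. B_pmf p))"
    using assms(2) by (intro Pi_pmf_bij_betw) (auto simp: bij_betw_def)
  also have "Pi_pmf (range (($) j)) 0 (\<lambda>_. B_pmf p) =
      map_pmf (\<lambda>f x. if x \<in> range (($) j) then f x else 0) (Pi_pmf {1..n} 0 (\<lambda>_. B_pmf p))"
    using assms(1) by (intro Pi_pmf_subset) auto
  finally show ?thesis
    by (simp add: B_vec_pmf_def map_pmf_comp restrict_to_def o_def)
qed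

text \<open>Perturbing the assignment \<open>x\<close> by independent random flips has expected value \<open>\<lambda>\<close>.\<close>

lemma csp_lambda_instance_le_val:
  assumes "csp_instance n \<Psi>"
  shows "csp_lambda f (instance_pmf \<Psi> x) p \<le> val f n \<Psi>"
proof -
  define Q where "Q = Pi_pmf {1..n} 0 (\<lambda>_. B_pmf p)"
  have "finite (set_pmf Q)"
    unfolding Q_def by (rule finite_subset[OF set_Pi_pmf_subset']) auto
  then have int: "integrable (measure_pmf Q) g" for g :: "(nat \<Rightarrow> bit) \<Rightarrow> real"
    by (rule integrable_measure_pmf_finite)
  have "csp_lambda f (instance_pmf \<Psi> x) p =
      1 / total_weight \<Psi> * (\<Sum>l<length \<Psi>. weight (\<Psi> ! l) *
        measure_pmf.expectation (B_vec_pmf p)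
          (\<lambda>a. of_bool (f (a + (lits (\<Psi> ! l) + restrict_to x (vars (\<Psi> ! l)))))))"
    by (simp add: csp_lambda_eq expectation_instance_pmf[OF assms])
  also have "\<dots> = 1 / total_weight \<Psi> * (\<Sum>l<length \<Psi>. weight (\<Psi> ! l) *
        measure_pmf.expectation Q
          (\<lambda>y. of_bool (f (lits (\<Psi> ! l) + restrict_to (\<lambda>i. x i + y i) (vars (\<Psi> ! l))))))"
  proof (intro arg_cong2[of _ _ _ _ "(*)"] sum.cong refl)
    fix l assume "l \<in> {..<length \<Psi>}"
    \<comment> \<open>The same random \<open>y\<close> serves all constraints. Their noises may be
      dependent, but linearity of expectation needs only the law for each constraint
      separately.\<close>
    then have B: "B_vec_pmf p = map_pmf (\<lambda>y. restrict_to y (vars (\<Psi> ! l))) Q"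
      unfolding Q_def using csp_instanceD(3,4)[OF assms]
      by (intro B_vec_pmf_restrict[symmetric]) auto
    have "restrict_to y (vars (\<Psi> ! l)) + (lits (\<Psi> ! l) + restrict_to x (vars (\<Psi> ! l))) =
        lits (\<Psi> ! l) + restrict_to (\<lambda>i. x i + y i) (vars (\<Psi> ! l))" for y
      by (simp add: vec_eq_iff restrict_to_def algebra_simps)
    note eq = this
    show "measure_pmf.expectation (B_vec_pmf p)
          (\<lambda>a. of_bool (f (a + (lits (\<Psi> ! l) + restrict_to x (vars (\<Psi> ! l)))))) =
        (measure_pmf.expectation Q
          (\<lambda>y. of_bool (f (lits (\<Psi> ! l) + restrict_to (\<lambda>i. x i + y i) (vars (\<Psi> ! l))))) :: real)"
      by (simp only: B integral_map_pmf eq)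
  qed
  also have "\<dots> = measure_pmf.expectation Q (\<lambda>y. val_at f \<Psi> (\<lambda>i. x i + y i))"
    by (simp only: val_at_def integral_mult_right_zero Bochner_Integration.integral_sum[OF int])
  also have "\<dots> \<le> val f n \<Psi>"
    by (rule measure_pmf.integral_le_const) (auto simp: int val_at_le_val[OF assms])
  finally show ?thesis .
qed

section \<open>Bias and mean Hamming weight\<close>

lemma sum_bias_at:
  fixes \<Psi> :: "'k::finite constr list"
  assumes "csp_instance n \<Psi>"
  shows "(\<Sum>i=1..n. c i * bias_at \<Psi> i) =
    (\<Sum>l<length \<Psi>. weight (\<Psi> ! l) *
      (\<Sum>s\<in>UNIV. bit_sign (lits (\<Psi> ! l) $ s) * c (vars (\<Psi> ! l) $ s)))"
proof -
  let ?S = "{..<length \<Psi>} \<times> (UNIV :: 'k set)"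
  let ?v = "\<lambda>(l, s). vars (\<Psi> ! l) $ s"
  let ?g = "\<lambda>(l, s). bit_sign (lits (\<Psi> ! l) $ s) * weight (\<Psi> ! l)"
  have "c i * bias_at \<Psi> i = (\<Sum>p\<in>{p \<in> ?S. ?v p = i}. c (?v p) * ?g p)" for i
  proof -
    have "{(l, s). l < length \<Psi> \<and> vars (\<Psi> ! l) $ s = i} = {p \<in> ?S. ?v p = i}"
      by auto
    then have "c i * bias_at \<Psi> i = (\<Sum>p\<in>{p \<in> ?S. ?v p = i}. c i * ?g p)"
      by (simp add: bias_at_def sum_distrib_left)
    then show ?thesis
      by simp
  qed
  then have "(\<Sum>i=1..n. c i * bias_at \<Psi> i) =
      (\<Sum>i=1..n. \<Sum>p\<in>{p \<in> ?S. ?v p = i}. c (?v p) * ?g p)"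
    by simp
  \<comment> \<open>Double counting: every occurrence \<open>(l, s)\<close> belongs to exactly one
    variable in \<open>{1..n}\<close>.\<close>
  also have "\<dots> = (\<Sum>p\<in>?S. c (?v p) * ?g p)"
    using csp_instanceD(3)[OF assms] by (intro sum.group) auto
  also have "\<dots> = (\<Sum>l<length \<Psi>. \<Sum>s\<in>UNIV.
      weight (\<Psi> ! l) * (bit_sign (lits (\<Psi> ! l) $ s) * c (vars (\<Psi> ! l) $ s)))"
    unfolding sum.cartesian_product by (intro sum.cong) (auto simp: mult_ac)
  finally show ?thesis
    by (simp add: sum_distrib_left)
qed

text \<open>The sign is multiplicative, so the signed sum of the biases is the weighted sum of all
  literal signs under \<open>x\<close>. Within one constraint these add up to
  \<open>CARD('k)\<close> minus twice the weight.\<close>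

lemma expectation_hamming_weight_instance:
  fixes \<Psi> :: "'k::finite constr list"
  assumes "csp_instance n \<Psi>"
  shows "measure_pmf.expectation (instance_pmf \<Psi> x) (\<lambda>a. real (hamming_weight a)) =
    CARD('k) / 2 - (\<Sum>i=1..n. bit_sign (x i) * bias_at \<Psi> i) / (2 * total_weight \<Psi>)"
proof -
  let ?a = "\<lambda>l. lits (\<Psi> ! l) + restrict_to x (vars (\<Psi> ! l))"
  note W = csp_instanceD(1)[OF assms]
  have mult: "bit_sign (b + c) = bit_sign b * bit_sign c" for b c
    by (cases b; cases c) (auto simp: bit_sign_def)
  have "(\<Sum>i=1..n. bit_sign (x i) * bias_at \<Psi> i) =
      (\<Sum>l<length \<Psi>. weight (\<Psi> ! l) * (\<Sum>s\<in>UNIV. bit_sign (?a l $ s)))"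
    by (simp only: sum_bias_at[OF assms] mult restrict_to_def vector_add_component vec_lambda_beta)
  also have "\<dots> = (\<Sum>l<length \<Psi>. weight (\<Psi> ! l) * (CARD('k) - 2 * real (hamming_weight (?a l))))"
    by (simp only: sum_bit_sign)
  also have "\<dots> = CARD('k) * total_weight \<Psi> -
      2 * (\<Sum>l<length \<Psi>. weight (\<Psi> ! l) * real (hamming_weight (?a l)))"
    by (simp add: right_diff_distrib sum_subtractf total_weight_def sum_distrib_left mult_ac)
  finally show ?thesis
    using W by (simp add: expectation_instance_pmf[OF assms] field_simps)
qed

lemma bias_nonneg:
  assumes "csp_instance n \<Psi>"
  shows "0 \<le> bias n \<Psi>"
  using csp_instanceD(1)[OF assms] by (auto simp: bias_def intro!: sum_nonneg divide_nonneg_nonneg)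

lemma val_Th_le:
  fixes \<Psi> :: "'k::finite constr list"
  assumes "csp_instance n \<Psi>" and "1 \<le> t"
  shows "val (Th t) n \<Psi> \<le> min 1 (CARD('k) * (1 + bias n \<Psi>) / (2 * t))"
proof -
  note W = csp_instanceD(1)[OF assms(1)]
  obtain x where x: "val (Th t) n \<Psi> = val_at (Th t) \<Psi> x"
    by (rule val_attained)
  let ?E = "measure_pmf.expectation (instance_pmf \<Psi> x)"
  have "(\<Sum>i=1..n. - (bit_sign (x i) * bias_at \<Psi> i)) \<le> (\<Sum>i=1..n. \<bar>bias_at \<Psi> i\<bar>)"
    by (intro sum_mono) (auto simp: bit_sign_def)
  also have "\<dots> = CARD('k) * total_weight \<Psi> * bias n \<Psi>"
    using W by (simp add: bias_def)
  finally have "- (\<Sum>i=1..n. bit_sign (x i) * bias_at \<Psi> i) \<le> CARD('k) * total_weight \<Psi> * bias n \<Psi>"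
    by (simp add: sum_negf)
  then have hw: "?E (\<lambda>a. real (hamming_weight a)) \<le> CARD('k) * (1 + bias n \<Psi>) / 2"
    using W by (simp add: expectation_hamming_weight_instance[OF assms(1)] field_simps)
  \<comment> \<open>Markov's inequality, by the pointwise bound of the indicator of weight at least
    \<open>t\<close>.\<close>
  have "?E (\<lambda>a. of_bool (Th t a)) \<le> ?E (\<lambda>a. real (hamming_weight a) / t)"
    using assms(2) by (intro integral_mono) (auto simp: Th_def)
  also have "\<dots> \<le> CARD('k) * (1 + bias n \<Psi>) / 2 / t"
    using divide_right_mono[OF hw, of "real t"] by simp
  finally have "?E (\<lambda>a. of_bool (Th t a)) \<le> CARD('k) * (1 + bias n \<Psi>) / (2 * t)"
    by (simp add: mult_ac)
  moreover have "?E (\<lambda>a. of_bool (Th t a)) \<le> (1 :: real)"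
    by (rule measure_pmf.integral_le_const) auto
  ultimately show ?thesis
    by (simp add: x val_at_eq_expectation[OF assms(1)])
qed

text \<open>A positive bias means that unnegated occurrences dominate, and the value 1 makes those
  literals 1. Hence every variable contributes \<open>- \<bar>bias_at \<Psi> i\<bar>\<close>, the
  least possible; ties contribute 0 either way.\<close>

lemma expectation_hamming_weight_majority:
  fixes \<Psi> :: "'k::finite constr list"
  assumes "csp_instance n \<Psi>"
  defines "x \<equiv> (\<lambda>i. if bias_at \<Psi> i > 0 then 1 else 0)"
  shows "measure_pmf.expectation (instance_pmf \<Psi> x) (\<lambda>a. real (hamming_weight a)) =
    CARD('k) * (1 + bias n \<Psi>) / 2"
proof -
  have "(\<Sum>i=1..n. bit_sign (x i) * bias_at \<Psi> i) = (\<Sum>i=1..n. - \<bar>bias_at \<Psi> i\<bar>)"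
    by (intro sum.cong) (auto simp: x_def bit_sign_def)
  then show ?thesis
    using csp_instanceD(1)[OF assms(1)]
    by (simp add: expectation_hamming_weight_instance[OF assms(1)] sum_negf bias_def field_simps)
qed

text \<open>The mean weight under the majority assignment cannot exceed
  \<open>CARD('k)\<close>.\<close>

lemma bias_le_1:
  fixes \<Psi> :: "'k::finite constr list"
  assumes "csp_instance n \<Psi>"
  shows "bias n \<Psi> \<le> 1"
proof -
  have "CARD('k) * (1 + bias n \<Psi>) / 2 \<le> CARD('k)"
    unfolding expectation_hamming_weight_majority[OF assms, symmetric]
    by (rule measure_pmf.integral_le_const) (auto simp: hamming_weight_le)
  then show ?thesis
    by (simp add: field_simps)
qed

lemma csp_alpha_Th_le_val:
  fixes \<Psi> :: "'k::finite constr list"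
  assumes "csp_instance n \<Psi>" and "1 \<le> t" and "t \<le> CARD('k)"
  shows "csp_alpha (Th t :: bit ^ 'k \<Rightarrow> bool) * min 1 (CARD('k) * (1 + bias n \<Psi>) / (2 * t)) \<le> val (Th t) n \<Psi>"
proof -
  let ?D = "instance_pmf \<Psi> (\<lambda>i. if bias_at \<Psi> i > 0 then 1 else 0)"
  have "CARD('k) * (1 + bias n \<Psi>) / 2 > 0"
    using bias_nonneg[OF assms(1)] by simp
  then have "csp_alpha (Th t :: bit ^ 'k \<Rightarrow> bool) * min 1 (CARD('k) * (1 + bias n \<Psi>) / 2 / t) \<le>
      csp_beta (Th t) ?D"
    using csp_alpha_Th_le_beta[OF assms(2,3), of ?D]
    by (simp add: expectation_hamming_weight_majority[OF assms(1)])
  also have "\<dots> \<le> val (Th t) n \<Psi>"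
    by (intro csp_beta_le csp_lambda_instance_le_val[OF assms(1)])
  finally show ?thesis
    by simp
qed


section \<open>The rounding function\<close>

text \<open>The ramp rises until \<open>r - 1\<close> and is constant from there. For
  \<open>r = 2\<close> this break point is the right end 1, and since break points must increase
  strictly, a single piece is used.\<close>

lemma piecewise_linear_on_ramp:
  assumes "0 < r" "r \<le> 2"
  shows "piecewise_linear_on (- 1) 1 (\<lambda>y. c * min 1 (max 0 ((1 + y) / r)))"
proof (cases "r = 2")
  case True
  show ?thesis
    unfolding piecewise_linear_on_def
  proof (intro exI conjI allI impI ballI)
    fix y :: real and i :: nat
    \<comment> \<open>The witnesses are \<open>N = 1\<close> and the break points
      \<open>2 * real i - 1\<close>, that is -1 and 1.\<close>
    assume "i < 1" and y: "y \<in> {2 * real i - 1..2 * real (Suc i) - 1}"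
    then show "c * min 1 (max 0 ((1 + y) / r)) = c / 2 * y + c / 2"
      using True by (simp add: field_simps)
  qed auto
next
  case False
  define x where "x i = (if i = 0 then - 1 else if i = 1 then r - 1 else 1)" for i :: nat
  have "\<exists>m d. \<forall>y\<in>{x i..x (Suc i)}. c * min 1 (max 0 ((1 + y) / r)) = m * y + d" if "i < 2" for i
  proof (cases "i = 0")
    case True
    show ?thesis
    proof (intro exI ballI)
      fix y assume "y \<in> {x i..x (Suc i)}"
      then have "- 1 \<le> y" "y \<le> r - 1"
        using True by (auto simp: x_def)
      then show "c * min 1 (max 0 ((1 + y) / r)) = c / r * y + c / r"
        using assms by (simp add: field_simps)
    qed
  next
    case False
    show ?thesis
    proof (intro exI ballI)
      fix y assume "y \<in> {x i..x (Suc i)}"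
      then have "r - 1 \<le> y"
        using False that by (auto simp: x_def)
      then show "c * min 1 (max 0 ((1 + y) / r)) = 0 * y + c"
        using assms by (simp add: min_def max_def field_simps)
    qed
  qed
  moreover have "x i < x (Suc i)" if "i < 2" for i
    using that assms False by (auto simp: x_def)
  ultimately show ?thesis
    unfolding piecewise_linear_on_def by (intro exI[of _ 2] exI[of _ x]) (auto simp: x_def)
qed

section \<open>Postprocessing the output of a sketch\<close>

lemma sketching_approximation_apply_to_output:
  assumes est: "sketching_bias_estimator I \<delta> s R"
    and meas: "g \<in> borel_measurable borel"
    and g: "\<And>n \<Psi> b. csp_instance n \<Psi> \<Longrightarrow> (1 - \<delta>) * bias n \<Psi> \<le> b \<Longrightarrow> b \<le> (1 + \<delta>) * bias n \<Psi> \<Longrightarrow>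
      \<rho> * val f n \<Psi> \<le> g b \<and> g b \<le> val f n \<Psi>"
  shows "sketching_approximation f \<rho> I s (\<lambda>n. apply_to_output g (R n))"
proof -
  \<comment> \<open>Only the output map changes, so the space bound and the combination of states
    carry over.\<close>
  have state: "state (run (apply_to_output g (R n)) \<omega>) = state (run (R n) \<omega>)" for n \<omega>
    by (simp add: fun_eq_iff state_def apply_to_output_def)
  have out: "alg_output (run (apply_to_output g (R n)) \<omega>) \<sigma> = g (alg_output (run (R n) \<omega>) \<sigma>)"
    for n \<omega> \<sigma>
    by (simp add: alg_output_def state) (simp add: apply_to_output_def)
  have seed: "seed (apply_to_output g (R n)) = seed (R n)" for n
    by (simp add: apply_to_output_def)
  have alg: "sketching_algorithm s R"
    using est by (simp add: sketching_bias_estimator_def)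
  then have "sketching_algorithm s (\<lambda>n. apply_to_output g (R n))"
    using measurable_compose[OF _ meas]
    unfolding sketching_algorithm_def det_sketching_def state out seed by blast
  moreover have "outputs_in (apply_to_output g (R n)) \<Psi> {\<rho> * val f n \<Psi>..val f n \<Psi>}"
    if "\<Psi> \<in> I n" and inst: "csp_instance n \<Psi>" for n \<Psi>
  proof -
    let ?S = "seed (R n)" and ?o = "\<lambda>\<omega>. alg_output (run (R n) \<omega>) \<Psi>"
    interpret prob_space ?S
      using alg by (simp add: sketching_algorithm_def)
    have [measurable]: "?o \<in> borel_measurable ?S"
      using alg inst by (auto simp: sketching_algorithm_def streams_def csp_instance_def)
    note meas[measurable]
    have "2/3 \<le> prob {\<omega> \<in> space ?S. ?o \<omega> \<in> {(1 - \<delta>) * bias n \<Psi>..(1 + \<delta>) * bias n \<Psi>}}"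
      using est that by (simp add: sketching_bias_estimator_def outputs_in_def)
    \<comment> \<open>A good estimate forces a good output; monotonicity needs the larger event to
      be measurable, hence the Borel assumption on \<open>g\<close>.\<close>
    also have "\<dots> \<le> prob {\<omega> \<in> space ?S. g (?o \<omega>) \<in> {\<rho> * val f n \<Psi>..val f n \<Psi>}}"
      using g[OF inst] by (intro finite_measure_mono) auto
    finally show ?thesis
      by (simp add: outputs_in_def out seed)
  qed
  ultimately show ?thesis
    by (simp add: sketching_approximation_def)
qed

section \<open>Robustness of the ramp and the approximation guarantee\<close>

lemma ramp_lipschitz:
  fixes b y r :: real
  assumes "r > 0"
  shows "\<bar>min 1 (max 0 ((1 + y) / r)) - min 1 (max 0 ((1 + b) / r))\<bar> \<le> \<bar>y - b\<bar> / r"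
proof -
  \<comment> \<open>Clamping to the unit interval is 1-Lipschitz.\<close>
  have "\<bar>min 1 (max 0 u) - min 1 (max 0 v)\<bar> \<le> \<bar>u - v\<bar>" for u v :: real
    by (auto simp: min_def max_def)
  from this[of "(1 + y) / r" "(1 + b) / r"] show ?thesis
    using assms by (simp add: diff_divide_distrib[symmetric] abs_divide)
qed

theorem theorem7p6:
  fixes t :: nat and \<epsilon> :: real
  assumes "CARD('k::finite) \<ge> 2" and "1 \<le> t" and "t \<le> CARD('k)" and "\<epsilon> > 0"
  shows "\<exists>(\<gamma> :: real \<Rightarrow> real) (\<epsilon>' :: real).
    piecewise_linear_on (- 1) 1 \<gamma> \<and> \<gamma> ` {- 1..1} \<subseteq> {0..1} \<and>
    (\<forall>b < - 1. \<gamma> b = \<gamma> (- 1)) \<and> (\<forall>b > 1. \<gamma> b = \<gamma> 1) \<and>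
    \<epsilon>' > 0 \<and>
    (\<forall>n (\<Psi> :: 'k constr list) b.
       csp_instance n \<Psi> \<longrightarrow> (1 - \<epsilon>') * bias n \<Psi> \<le> b \<longrightarrow> b \<le> (1 + \<epsilon>') * bias n \<Psi> \<longrightarrow>
       (csp_alpha (Th t :: bit ^ 'k \<Rightarrow> bool) - \<epsilon>) * val (Th t) n \<Psi> \<le> \<gamma> b \<and>
       \<gamma> b \<le> val (Th t) n \<Psi>) \<and>
    (\<forall>(I :: nat \<Rightarrow> 'k constr list set) s R.
       sketching_bias_estimator I \<epsilon>' s R \<longrightarrow>
       sketching_approximation (Th t)
         (csp_alpha (Th t :: bit ^ 'k \<Rightarrow> bool) - \<epsilon>) I s (\<lambda>n. apply_to_output \<gamma> (R n)))"
proof -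
  define k where "k = real CARD('k)"
  define \<alpha> where "\<alpha> = csp_alpha (Th t :: bit ^ 'k \<Rightarrow> bool)"
  \<comment> \<open>Half of \<epsilon> is reserved for the estimation error; the truncation keeps
    \<gamma> nonnegative.\<close>
  define c where "c = max 0 (\<alpha> - \<epsilon> / 2)"
  \<comment> \<open>Chosen so that \<open>(1 + y) / r\<close> is
    \<open>k * (1 + y) / (2 * t)\<close>, the bound of \<open>val_Th_le\<close>.\<close>
  define r where "r = 2 * t / k"
  define G where "G y = min 1 (max 0 ((1 + y) / r))" for y
  define \<gamma> where "\<gamma> y = c * G y" for y
  \<comment> \<open>The ramp has slope at most \<open>1 / r\<close>, hence at most
    \<open>k / 2\<close>, and the bias is at most 1. So \<open>G\<close> moves by at most
    \<open>\<delta> * k / 2 = \<epsilon> / 4\<close>, which is within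
    \<open>\<epsilon> / 2 * G ?b\<close> because \<open>G ?b\<close> is at least 1/2.\<close>
  define \<delta> where "\<delta> = \<epsilon> / (2 * k)"
  have k: "k > 0" and r: "0 < r" "r \<le> 2" and \<delta>: "\<delta> > 0" "\<delta> * k = \<epsilon> / 2"
    using assms by (auto simp: k_def r_def \<delta>_def divide_le_eq)
  obtain a :: "bit ^ 'k" where "Th t a"
    using assms(3) exists_hamming_weight[of t] by (metis Th_def order_refl)
  then have \<alpha>: "\<alpha> \<le> 1"
    unfolding \<alpha>_def by (rule csp_alpha_le_1)
  have G: "0 \<le> G y" "G y \<le> 1" for y
    by (auto simp: G_def)
  have bounds: "(\<alpha> - \<epsilon>) * val (Th t) n \<Psi> \<le> \<gamma> y \<and> \<gamma> y \<le> val (Th t) n \<Psi>"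
    if inst: "csp_instance n \<Psi>" and y: "(1 - \<delta>) * bias n \<Psi> \<le> y" "y \<le> (1 + \<delta>) * bias n \<Psi>"
    for n and \<Psi> :: "'k constr list" and y
  proof -
    let ?b = "bias n \<Psi>" and ?v = "val (Th t) n \<Psi>"
    have b: "0 \<le> ?b" "?b \<le> 1"
      using bias_nonneg[OF inst] bias_le_1[OF inst] by auto
    have Gb: "G ?b = min 1 (k * (1 + ?b) / (2 * real t))"
      using b k by (simp add: G_def r_def mult.commute)
    have up: "?v \<le> G ?b"
      unfolding Gb k_def by (rule val_Th_le[OF inst assms(2)])
    have low: "\<alpha> * G ?b \<le> ?v"
      unfolding Gb k_def \<alpha>_def by (rule csp_alpha_Th_le_val[OF inst assms(2,3)])
    have v: "0 \<le> ?v"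
      by (rule val_nonneg[OF inst])
    have G1: "1 / r \<le> k / 2"
      using assms(2) k by (simp add: r_def field_simps)
    have "1 / 2 \<le> (1 + ?b) / r"
      using b r by (intro frac_le) auto
    then have G2: "1 / 2 \<le> G ?b"
      unfolding G_def by linarith
    have "\<bar>G y - G ?b\<bar> \<le> \<bar>y - ?b\<bar> / r"
      unfolding G_def using r(1) by (rule ramp_lipschitz)
    also have "\<dots> \<le> \<delta> / r"
    proof (rule divide_right_mono)
      have "\<bar>y - ?b\<bar> \<le> \<delta> * ?b"
        using y by (simp add: algebra_simps abs_le_iff)
      also have "\<dots> \<le> \<delta>"
        using b \<delta> by (simp add: mult_left_le)
      finally show "\<bar>y - ?b\<bar> \<le> \<delta>" .
    qed (use r in simp)
    also have "\<dots> \<le> \<delta> * (k / 2)"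
      using mult_left_mono[OF G1, of \<delta>] \<delta>(1) by simp
    also have "\<dots> \<le> \<epsilon> / 2 * G ?b"
      using mult_left_mono[OF G2, of "\<epsilon> / 2"] assms(4) \<delta>(2) by simp
    finally have diff: "\<bar>G y - G ?b\<bar> \<le> \<epsilon> / 2 * G ?b" .
    then have Gy: "(1 - \<epsilon> / 2) * G ?b \<le> G y" "G y \<le> (1 + \<epsilon> / 2) * G ?b"
      by (simp_all only: abs_le_iff left_diff_distrib distrib_right mult_1_left) linarith+
    have c: "0 \<le> c" "c \<le> 1"
      using \<alpha> assms(4) by (auto simp: c_def)
    have \<gamma>0: "0 \<le> \<gamma> y"
      using c G by (simp add: \<gamma>_def)
    have "\<gamma> y \<le> ?v"
    proof (cases "\<alpha> \<le> \<epsilon> / 2")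
      case True
      then show ?thesis
        using v by (simp add: \<gamma>_def c_def)
    next
      case False
      have "\<gamma> y \<le> c * ((1 + \<epsilon> / 2) * G ?b)"
        unfolding \<gamma>_def using Gy(2) c(1) by (rule mult_left_mono)
      also have "\<dots> = (c + c * (\<epsilon> / 2)) * G ?b"
        by (simp add: algebra_simps)
      \<comment> \<open>Here \<open>c = \<alpha> - \<epsilon> / 2\<close>, and
        \<open>c * (\<epsilon> / 2)\<close> uses up at most the missing half because
        \<open>c\<close> is at most 1.\<close>
      also have "\<dots> \<le> \<alpha> * G ?b"
      proof (rule mult_right_mono[OF _ G(1)])
        have "c * (\<epsilon> / 2) \<le> \<epsilon> / 2"
          using c assms(4) by (intro mult_left_le_one_le) auto
        then show "c + c * (\<epsilon> / 2) \<le> \<alpha>"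
          using False by (simp add: c_def)
      qed
      finally show ?thesis
        using low by linarith
    qed
    moreover have "(\<alpha> - \<epsilon>) * ?v \<le> \<gamma> y"
    proof (cases "\<alpha> \<le> \<epsilon>")
      case True
      then have "(\<alpha> - \<epsilon>) * ?v \<le> 0"
        using v by (intro mult_nonpos_nonneg) auto
      then show ?thesis
        using \<gamma>0 by linarith
    next
      case False
      have "(\<alpha> - \<epsilon>) * ?v \<le> (\<alpha> - \<epsilon>) * G ?b"
        using False up by (intro mult_left_mono) auto
      also have "\<dots> \<le> (c - c * (\<epsilon> / 2)) * G ?b"
      proof (rule mult_right_mono[OF _ G(1)])
        have "c * (\<epsilon> / 2) \<le> \<epsilon> / 2"
          using c assms(4) by (intro mult_left_le_one_le) auto
        then show "\<alpha> - \<epsilon> \<le> c - c * (\<epsilon> / 2)"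
          by (simp add: c_def)
      qed
      also have "\<dots> = c * ((1 - \<epsilon> / 2) * G ?b)"
        by (simp add: algebra_simps)
      also have "\<dots> \<le> \<gamma> y"
        unfolding \<gamma>_def using Gy(1) c(1) by (rule mult_left_mono)
      finally show ?thesis .
    qed
    ultimately show ?thesis
      by simp
  qed
  have "piecewise_linear_on (- 1) 1 \<gamma>"
    unfolding \<gamma>_def G_def by (rule piecewise_linear_on_ramp[OF r])
  moreover have "\<gamma> ` {- 1..1} \<subseteq> {0..1}"
    using G \<alpha> assms(4) by (auto simp: \<gamma>_def c_def intro!: mult_le_one)
  \<comment> \<open>An estimate may exceed 1, so the values of \<gamma> beyond the interval matter
    as well.\<close>
  moreover have "\<forall>b < - 1. \<gamma> b = \<gamma> (- 1)"
    using r by (simp add: \<gamma>_def G_def max_absorb1 divide_nonpos_pos)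
  moreover have "\<forall>b > 1. \<gamma> b = \<gamma> 1"
    using r by (simp add: \<gamma>_def G_def)
  moreover have "\<gamma> \<in> borel_measurable borel"
    unfolding \<gamma>_def G_def by measurable
  then have "sketching_approximation (Th t) (\<alpha> - \<epsilon>) I s (\<lambda>n. apply_to_output \<gamma> (R n))"
    if "sketching_bias_estimator I \<delta> s R"
    for I :: "nat \<Rightarrow> 'k constr list set" and s and R :: "nat \<Rightarrow> 'k rand_alg"
    using that bounds by (intro sketching_approximation_apply_to_output[where \<delta> = \<delta>])
  ultimately show ?thesis
    using \<delta>(1) bounds unfolding \<alpha>_def[symmetric]
    by (intro exI[of _ \<gamma>] exI[of _ \<delta>] conjI allI impI) auto
qed

end
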